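(* Let $\mathbf P=(P,x_L,x_R)$ be an oriented poset with vertex weights $w$. The weight matrices corresponding to the target loops $\lhd(\mathbf P\!\searrow)$ and $\lhd(\mathbf P\!\nearrow)$ are given by $$\mathcal M_w\big((\lhd(\mathbf P\!\searrow))\!\searrow\big)=\mathrm{loop}_t\big(\mathcal M_w(\mathbf P\!\searrow)\big),\qquad \mathcal M_w\big((\lhd(\mathbf P\!\nearrow))\!\searrow\big)=\mathrm{loop}_t\big(\mathcal M_w(\mathbf P\!\nearrow)\big),$$ where $$\mathrm{loop}_t\begin{bmatrix}a&b\\c&d\end{bmatrix}=\begin{bmatrix}a+d&c-a\\c+d&0\end{bmatrix}.$$
   Context: An oriented poset $\mathbf P=(P,x_L,x_R)$ is a finite poset $P$ with two specified vertices $x_L$ (left, or target vertex) and $x_R$ (right, or source vertex), possibly equal. Each vertex $i$ of $P$ carries a weight variable $w_i$. An order ideal is a down-closed subset, $J(P)$ is the set of order ideals, and $\mathcal W(P;w)=\sum_{I\in J(P)}\prod_{i\in I}w_i$ is the weight polynomial. A restriction such as $\mathcal W(\mathbf P;w)|_{x_R\in I,\,x_L\notin I}$ means that the sum is only over ideals $I$ satisfying the stated conditions. Down-pointing weight matrix: $$\mathcal M_w(\mathbf P\!\searrow)=\begin{bmatrix}\mathcal W(\mathbf P;w)&-\mathcal W(\mathbf P;w)|_{x_R\in I}\\ \mathcal W(\mathbf P;w)|_{x_L\notin I}&-\mathcal W(\mathbf P;w)|_{x_R\in I,\,x_L\notin I}\end{bmatrix}.$$ Up-pointing weight matrix: $$\mathcal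 M_w(\mathbf P\!\nearrow)=\begin{bmatrix}\mathcal W(\mathbf P;w)|_{x_R\in I}&\mathcal W(\mathbf P;w)|_{x_R\notin I}\\ \mathcal W(\mathbf P;w)|_{x_R\in I,\,x_L\notin I}&\mathcal W(\mathbf P;w)|_{x_R\notin I,\,x_L\notin I}\end{bmatrix}.$$ $\circlearrowright(\mathbf P\!\searrow)$ denotes the poset obtained from $P$ by adding the relation $x_L\preceq x_R$, and $\circlearrowright(\mathbf P\!\nearrow)$ the poset obtained by adding the relation $x_L\succeq x_R$ (in both cases taking the transitive closure, which is understood to be again a partial order). The target loops are the oriented posets $\lhd(\mathbf P\!\searrow)=(\circlearrowright(\mathbf P\!\searrow),x_L,x_L)$ and $\lhd(\mathbf P\!\nearrow)=(\circlearrowright(\mathbf P\!\nearrow),x_L,x_L)$, whose target and source vertices are both $x_L$. *)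

theory Defs
  imports "HOL-Analysis.Cartesian_Space"
begin

(* P = (verts P, ord_rel P), where (x, y) : ord_rel P means x <= y;
   xL is the left (target) vertex, xR the right (source) vertex. *)
record 'a oriented_poset =
  verts :: "'a set"
  ord_rel :: "'a rel"
  xL :: 'a
  xR :: 'a

definition oriented_poset :: "'a oriented_poset \<Rightarrow> bool" where
  "oriented_poset P \<longleftrightarrow>
     finite (verts P) \<and> partial_order_on (verts P) (ord_rel P) \<and> xL P \<in> verts P \<and> xR P \<in> verts P"

definition order_ideals :: "'a oriented_poset \<Rightarrow> 'a set set" where
  "order_ideals P = {I. I \<subseteq> verts P \<and> (\<forall>x y. (x, y) \<in> ord_rel P \<longrightarrow> y \<in> I \<longrightarrow> x \<in> I)}"

(* The weight polynomial restricted to the ideals satisfying C.  The weights are elements of an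
   arbitrary commutative ring; weight variables are the case of a polynomial ring. *)
definition weight_restr ::
    "'a oriented_poset \<Rightarrow> ('a \<Rightarrow> 'r::comm_ring_1) \<Rightarrow> ('a set \<Rightarrow> bool) \<Rightarrow> 'r" where
  "weight_restr P w C = (\<Sum>I\<in>{I \<in> order_ideals P. C I}. \<Prod>i\<in>I. w i)"

definition weight_poly :: "'a oriented_poset \<Rightarrow> ('a \<Rightarrow> 'r::comm_ring_1) \<Rightarrow> 'r" where
  "weight_poly P w = (\<Sum>I\<in>order_ideals P. \<Prod>i\<in>I. w i)"

(* vector lists the rows of the matrix; M $ i $ j is the entry in row i, column j. *)
definition weight_matrix_down ::
    "'a oriented_poset \<Rightarrow> ('a \<Rightarrow> 'r::comm_ring_1) \<Rightarrow> 'r^2^2" where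
  "weight_matrix_down P w = vector
     [vector [weight_poly P w,
              - weight_restr P w (\<lambda>I. xR P \<in> I)],
      vector [weight_restr P w (\<lambda>I. xL P \<notin> I),
              - weight_restr P w (\<lambda>I. xR P \<in> I \<and> xL P \<notin> I)]]"

definition weight_matrix_up ::
    "'a oriented_poset \<Rightarrow> ('a \<Rightarrow> 'r::comm_ring_1) \<Rightarrow> 'r^2^2" where
  "weight_matrix_up P w = vector
     [vector [weight_restr P w (\<lambda>I. xR P \<in> I),
              weight_restr P w (\<lambda>I. xR P \<notin> I)],
      vector [weight_restr P w (\<lambda>I. xR P \<in> I \<and> xL P \<notin> I),
              weight_restr P w (\<lambda>I. xR P \<notin> I \<and> xL P \<notin> I)]]"

definition circ_down :: "'a oriented_poset \<Rightarrow> 'a rel" where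
  "circ_down P = (insert (xL P, xR P) (ord_rel P))\<^sup>+"

definition circ_up :: "'a oriented_poset \<Rightarrow> 'a rel" where
  "circ_up P = (insert (xR P, xL P) (ord_rel P))\<^sup>+"

definition target_loop_down :: "'a oriented_poset \<Rightarrow> 'a oriented_poset" where
  "target_loop_down P = \<lparr>verts = verts P, ord_rel = circ_down P, xL = xL P, xR = xL P\<rparr>"

definition target_loop_up :: "'a oriented_poset \<Rightarrow> 'a oriented_poset" where
  "target_loop_up P = \<lparr>verts = verts P, ord_rel = circ_up P, xL = xL P, xR = xL P\<rparr>"

definition loop_t :: "'r::comm_ring_1^2^2 \<Rightarrow> 'r^2^2" where
  "loop_t M = vector
     [vector [M$1$1 + M$2$2, M$2$1 - M$1$1],
      vector [M$2$1 + M$2$2, 0]]"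

end

theory Submission
  imports Defs
begin

text \<open>
  Adding the relation \<open>x\<^sub>L \<preceq> x\<^sub>R\<close> keeps exactly those ideals that contain \<open>x\<^sub>L\<close> whenever they
  contain \<open>x\<^sub>R\<close>; passing to the transitive closure excludes no further ideals.  Hence every entry
  for a target loop is a restricted weight polynomial of the original poset, and the entries of
  \<open>loop\<^sub>t\<close> result from splitting these by whether the ideal contains \<open>x\<^sub>L\<close> and \<open>x\<^sub>R\<close>.
\<close>

text \<open>A chain of \<open>r\<close>-steps carries membership in \<open>I\<close> down one step
  at a time.\<close>

lemma closed_under_trancl_iff:
  "(\<forall>x y. (x, y) \<in> r\<^sup>+ \<longrightarrow> y \<in> I \<longrightarrow> x \<in> I) \<longleftrightarrow> (\<forall>x y. (x, y) \<in> r \<longrightarrow> y \<in> I \<longrightarrow> x \<in> I)"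
proof (intro iffI allI impI)
  fix x y
  assume closed: "\<forall>x y. (x, y) \<in> r \<longrightarrow> y \<in> I \<longrightarrow> x \<in> I" and "(x, y) \<in> r\<^sup>+" "y \<in> I"
  from this(2,3) show "x \<in> I"
    by (induction rule: trancl_induct) (use closed in blast)+
qed blast

text \<open>Generic \<open>u\<close> and \<open>v\<close> serve both loops: the roles of
  \<open>xL\<close> and \<open>xR\<close> swap between them.\<close>

lemma order_ideals_insert_trancl:
  assumes "verts Q = verts P" "ord_rel Q = (insert (u, v) (ord_rel P))\<^sup>+"
  shows "order_ideals Q = {I \<in> order_ideals P. v \<in> I \<longrightarrow> u \<in> I}"
  unfolding order_ideals_def assms closed_under_trancl_iff by blast

lemma finite_order_ideals: "finite (verts P) \<Longrightarrow> finite (order_ideals P)"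
  by (rule finite_subset[of _ "Pow (verts P)"]) (auto simp: order_ideals_def)

lemma weight_poly_eq_weight_restr: "weight_poly P w = weight_restr P w (\<lambda>I. True)"
  by (simp add: weight_poly_def weight_restr_def)

lemma weight_restr_False: "weight_restr P w (\<lambda>I. False) = 0"
  by (simp add: weight_restr_def)

lemma weight_restr_insert_trancl:
  assumes "verts Q = verts P" "ord_rel Q = (insert (u, v) (ord_rel P))\<^sup>+"
  shows "weight_restr Q w C = weight_restr P w (\<lambda>I. (v \<in> I \<longrightarrow> u \<in> I) \<and> C I)"
  unfolding weight_restr_def order_ideals_insert_trancl[OF assms]
  by (rule sum.cong) auto

text \<open>Finiteness matters because \<open>sum\<close> defaults to 0 on infinite sets, which
  would break additivity.\<close>

lemma weight_restr_split:
  assumes "finite (verts P)"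
    and "\<And>I. C I \<longleftrightarrow> D I \<or> E I" "\<And>I. \<not> (D I \<and> E I)"
  shows "weight_restr P w C = weight_restr P w D + weight_restr P w E"
proof -
  have "{I \<in> order_ideals P. C I} = {I \<in> order_ideals P. D I} \<union> {I \<in> order_ideals P. E I}"
    using assms(2) by blast
  moreover have "{I \<in> order_ideals P. D I} \<inter> {I \<in> order_ideals P. E I} = {}"
    using assms(3) by blast
  ultimately show ?thesis
    using finite_order_ideals[OF assms(1)] by (simp add: weight_restr_def sum.union_disjoint)
qed

lemma weight_matrix_down_target_loop_down:
  assumes "finite (verts P)"
  shows "weight_matrix_down (target_loop_down P) w = loop_t (weight_matrix_down P w)"
proof -
  let ?W = "weight_restr P w"
  have restr: "weight_restr (target_loop_down P) w C = ?W (\<lambda>I. (xR P \<in> I \<longrightarrow> xL P \<in> I) \<and> C I)" for C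
    by (rule weight_restr_insert_trancl) (simp_all add: target_loop_down_def circ_down_def)
  have ends: "xL (target_loop_down P) = xL P" "xR (target_loop_down P) = xL P"
    by (simp_all add: target_loop_down_def)
  \<comment> \<open>The three splits give the entries a + d, c - a and c + d. Here d carries a minus
    sign, so adding it removes the ideals that violate the new relation. The last entry is 0 since
    source and target coincide.\<close>
  have "?W (\<lambda>I. True) = ?W (\<lambda>I. xR P \<in> I \<longrightarrow> xL P \<in> I) + ?W (\<lambda>I. xR P \<in> I \<and> xL P \<notin> I)"
    by (rule weight_restr_split[OF assms]) blast+
  moreover have "?W (\<lambda>I. True) = ?W (\<lambda>I. (xR P \<in> I \<longrightarrow> xL P \<in> I) \<and> xL P \<in> I) + ?W (\<lambda>I. xL P \<notin> I)"
    by (rule weight_restr_split[OF assms]) blast+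
  moreover have "?W (\<lambda>I. xL P \<notin> I) =
      ?W (\<lambda>I. (xR P \<in> I \<longrightarrow> xL P \<in> I) \<and> xL P \<notin> I) + ?W (\<lambda>I. xR P \<in> I \<and> xL P \<notin> I)"
    by (rule weight_restr_split[OF assms]) blast+
  ultimately show ?thesis
    by (simp add: weight_matrix_down_def loop_t_def vec_eq_iff forall_2
        weight_poly_eq_weight_restr restr ends weight_restr_False)
qed

lemma weight_matrix_down_target_loop_up:
  assumes "finite (verts P)"
  shows "weight_matrix_down (target_loop_up P) w = loop_t (weight_matrix_up P w)"
proof -
  let ?W = "weight_restr P w"
  have restr: "weight_restr (target_loop_up P) w C = ?W (\<lambda>I. (xL P \<in> I \<longrightarrow> xR P \<in> I) \<and> C I)" for C
    by (rule weight_restr_insert_trancl) (simp_all add: target_loop_up_def circ_up_def)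
  have ends: "xL (target_loop_up P) = xL P" "xR (target_loop_up P) = xL P"
    by (simp_all add: target_loop_up_def)
  \<comment> \<open>Here d has no sign, so a + d and c + d join disjoint classes of ideals; c - a
    leaves minus the ideals containing both \<open>xL P\<close> and \<open>xR P\<close>.\<close>
  have "?W (\<lambda>I. xL P \<in> I \<longrightarrow> xR P \<in> I) = ?W (\<lambda>I. xR P \<in> I) + ?W (\<lambda>I. xR P \<notin> I \<and> xL P \<notin> I)"
    by (rule weight_restr_split[OF assms]) blast+
  moreover have "?W (\<lambda>I. xR P \<in> I) =
      ?W (\<lambda>I. (xL P \<in> I \<longrightarrow> xR P \<in> I) \<and> xL P \<in> I) + ?W (\<lambda>I. xR P \<in> I \<and> xL P \<notin> I)"
    by (rule weight_restr_split[OF assms]) blast+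
  moreover have "?W (\<lambda>I. (xL P \<in> I \<longrightarrow> xR P \<in> I) \<and> xL P \<notin> I) =
      ?W (\<lambda>I. xR P \<in> I \<and> xL P \<notin> I) + ?W (\<lambda>I. xR P \<notin> I \<and> xL P \<notin> I)"
    by (rule weight_restr_split[OF assms]) blast+
  ultimately show ?thesis
    by (simp add: weight_matrix_down_def weight_matrix_up_def loop_t_def vec_eq_iff forall_2
        weight_poly_eq_weight_restr restr ends weight_restr_False)
qed

text \<open>Each half has its own guard: if \<open>xL P\<close> and \<open>xR P\<close> are distinct
  and comparable, one of the two closures fails antisymmetry.\<close>

theorem theorem5p6:
  fixes P :: "'a oriented_poset" and w :: "'a \<Rightarrow> 'r::comm_ring_1"
  assumes "oriented_poset P"
  shows "(partial_order_on (verts P) (circ_down P) \<longrightarrow>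
            weight_matrix_down (target_loop_down P) w = loop_t (weight_matrix_down P w)) \<and>
         (partial_order_on (verts P) (circ_up P) \<longrightarrow>
            weight_matrix_down (target_loop_up P) w = loop_t (weight_matrix_up P w))"
  using assms weight_matrix_down_target_loop_down weight_matrix_down_target_loop_up
  by (auto simp: oriented_poset_def)

end
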